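(* Let $\{X_t\}_{t\ge 0}$ be a (strictly) stationary INAR(1) process with parameters $(m,r)$, for some $(m,r)\in\mathcal R_1$, and innovation sequence $\{\epsilon_t\}$. (i) The marginal pgf $\phi_X(s)$ of $\{X_t\}$ satisfies $\phi_X(s)=\phi_X(\psi_{m,r}(s))\,\phi_\epsilon(s)$. (ii) Assuming $\mu_\epsilon<\infty$ and $\sigma_\epsilon^2<\infty$ (and $X_t$ non-degenerate, so that the correlation is defined), the correlation coefficient of $\{X_t\}$ at lag $k$ is $\rho(k)=m^k$. (iii) Assuming $\mu_\epsilon<\infty$ and $\sigma_\epsilon^2<\infty$, the marginal mean $\mu_X$ and variance $\sigma_X^2$ of $\{X_t\}$ are $$\mu_X=\frac{\mu_\epsilon}{1-m}\quad\text{and}\quad \sigma_X^2=\frac{m(2r+1-m)\mu_X+\sigma_\epsilon^2}{1-m^2}.$$ (iv) The joint pgf of $(X_{t-1},X_t)$ is $$\phi_1(s_1,s_2)=\frac{\phi_X(s_1\psi_{m,r}(s_2))\,\phi_X(s_2)}{\phi_X(\psi_{m,r}(s_2))}.$$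
   Context: $\mathcal R_1=\{(m,r)\in\mathbb R^2: r\ge 0,\ 0<m<1\}$. For $(m,r)\in\mathcal R_1$, $\psi_{m,r}(s)=1-m\frac{1-s}{1+r(1-s)}$, $s\in[0,1]$ (a probability generating function, pgf). An INAR(1) process with parameters $(m,r)$ is a sequence $(X_t,t\ge0)$ of $\mathbb Z_+$-valued random variables such that for every $t\ge1$, $$X_t=(m,r)\odot X_{t-1}+\epsilon_t,\qquad (m,r)\odot X_{t-1}=\sum_{i=1}^{X_{t-1}}Z_{i,t-1},$$ where $(Z_{i,t})$ is an array of iid $\mathbb Z_+$-valued random variables with common pgf $\psi_{m,r}$, $(\epsilon_t,t\ge1)$ is an iid sequence of $\mathbb Z_+$-valued random variables (the innovation sequence), and $X_0$, $(\epsilon_t)$ and $(Z_{i,t})$ are mutually independent. $\mu_\epsilon$, $\sigma_\epsilon^2$ and $\phi_\epsilon(s)$ denote the common mean, variance and pgf of the $\epsilon_t$; $\rho(k)$ is the correlation coefficient of $X_{t-k}$ and $X_t$; $\phi_1(s_1,s_2)=E(s_1^{X_{t-1}}s_2^{X_t})$ for $s_1,s_2\in[0,1]$. *)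

theory Defs
  imports "HOL-Probability.Probability"
begin

definition R1 :: "(real \<times> real) set" where
  "R1 = {(m, r). r \<ge> 0 \<and> 0 < m \<and> m < 1}"

definition psi :: "real \<Rightarrow> real \<Rightarrow> real \<Rightarrow> real" where
  "psi m r s = 1 - m * ((1 - s) / (1 + r * (1 - s)))"

text \<open>Probability generating functions are used for arguments in \<open>[0,1]\<close> only, where the
  integrands are bounded; \<open>0 ^ 0 = 1\<close>, as is conventional for generating functions.\<close>

definition pgf :: "'a measure \<Rightarrow> ('a \<Rightarrow> nat) \<Rightarrow> real \<Rightarrow> real" where
  "pgf M Y s = (\<integral>\<omega>. s ^ Y \<omega> \<partial>M)"

definition joint_pgf :: "'a measure \<Rightarrow> ('a \<Rightarrow> nat) \<Rightarrow> ('a \<Rightarrow> nat) \<Rightarrow> real \<Rightarrow> real \<Rightarrow> real" where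
  "joint_pgf M Y W s1 s2 = (\<integral>\<omega>. s1 ^ Y \<omega> * s2 ^ W \<omega> \<partial>M)"

text \<open>The Bochner integral of a non-integrable function is \<open>0\<close>, so the finiteness of a mean or
  of a variance is expressed separately.\<close>

definition mean :: "'a measure \<Rightarrow> ('a \<Rightarrow> nat) \<Rightarrow> real" where
  "mean M Y = (\<integral>\<omega>. real (Y \<omega>) \<partial>M)"

definition finite_mean :: "'a measure \<Rightarrow> ('a \<Rightarrow> nat) \<Rightarrow> bool" where
  "finite_mean M Y \<longleftrightarrow> integrable M (\<lambda>\<omega>. real (Y \<omega>))"

definition var :: "'a measure \<Rightarrow> ('a \<Rightarrow> nat) \<Rightarrow> real" where
  "var M Y = (\<integral>\<omega>. (real (Y \<omega>) - mean M Y)\<^sup>2 \<partial>M)"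

definition finite_var :: "'a measure \<Rightarrow> ('a \<Rightarrow> nat) \<Rightarrow> bool" where
  "finite_var M Y \<longleftrightarrow> integrable M (\<lambda>\<omega>. (real (Y \<omega>) - mean M Y)\<^sup>2)"

definition cov :: "'a measure \<Rightarrow> ('a \<Rightarrow> nat) \<Rightarrow> ('a \<Rightarrow> nat) \<Rightarrow> real" where
  "cov M Y W = (\<integral>\<omega>. (real (Y \<omega>) - mean M Y) * (real (W \<omega>) - mean M W) \<partial>M)"

definition corr :: "'a measure \<Rightarrow> ('a \<Rightarrow> nat) \<Rightarrow> ('a \<Rightarrow> nat) \<Rightarrow> real" where
  "corr M Y W = cov M Y W / (sqrt (var M Y) * sqrt (var M W))"

definition degenerate :: "'a measure \<Rightarrow> ('a \<Rightarrow> nat) \<Rightarrow> bool" where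
  "degenerate M Y \<longleftrightarrow> (\<exists>c. AE \<omega> in M. Y \<omega> = c)"

definition same_distr :: "'a measure \<Rightarrow> ('a \<Rightarrow> nat) \<Rightarrow> ('a \<Rightarrow> nat) \<Rightarrow> bool" where
  "same_distr M Y W \<longleftrightarrow> distr M (count_space UNIV) Y = distr M (count_space UNIV) W"

text \<open>Strict stationarity: all finite-dimensional distributions are invariant under time shifts.\<close>

definition strictly_stationary :: "'a measure \<Rightarrow> (nat \<Rightarrow> 'a \<Rightarrow> nat) \<Rightarrow> bool" where
  "strictly_stationary M X \<longleftrightarrow>
    (\<forall>J h. finite J \<longrightarrow>
      distr M (PiM J (\<lambda>_. count_space UNIV)) (\<lambda>\<omega>. \<lambda>t\<in>J. X (t + h) \<omega>) =
      distr M (PiM J (\<lambda>_. count_space UNIV)) (\<lambda>\<omega>. \<lambda>t\<in>J. X t \<omega>))"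

text \<open>Names for the driving random variables \<open>X\<^sub>0\<close>, \<open>\<epsilon>\<^sub>t\<close> (\<open>t \<ge> 1\<close>) and \<open>Z\<^sub>i\<^sub>,\<^sub>t\<close> (\<open>i \<ge> 1\<close>, \<open>t \<ge> 0\<close>).
  Independence within the sequence \<open>(\<epsilon>\<^sub>t)\<close>, independence within the array \<open>(Z\<^sub>i\<^sub>,\<^sub>t)\<close> and mutual
  independence of \<open>X\<^sub>0\<close>, \<open>(\<epsilon>\<^sub>t)\<close> and \<open>(Z\<^sub>i\<^sub>,\<^sub>t)\<close> together say that the single family of all these
  variables is independent.\<close>

datatype driver = Init | Innov nat | Count nat nat

definition drivers :: "driver set" where
  "drivers = {Init} \<union> {Innov t |t. t \<ge> 1} \<union> {Count i t |i t. i \<ge> 1}"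

fun driver_var ::
    "('a \<Rightarrow> nat) \<Rightarrow> (nat \<Rightarrow> 'a \<Rightarrow> nat) \<Rightarrow> (nat \<Rightarrow> nat \<Rightarrow> 'a \<Rightarrow> nat) \<Rightarrow> driver \<Rightarrow> 'a \<Rightarrow> nat" where
  "driver_var X0 eps Z Init = X0"
| "driver_var X0 eps Z (Innov t) = eps t"
| "driver_var X0 eps Z (Count i t) = Z i t"

text \<open>The thinned variable \<open>(m,r) \<odot> X\<^sub>t\<close>; the parameters enter through the law of \<open>Z\<close>.\<close>

definition thin :: "(nat \<Rightarrow> nat \<Rightarrow> 'a \<Rightarrow> nat) \<Rightarrow> (nat \<Rightarrow> 'a \<Rightarrow> nat) \<Rightarrow> nat \<Rightarrow> 'a \<Rightarrow> nat" where
  "thin Z X t \<omega> = (\<Sum>i = 1..X t \<omega>. Z i t \<omega>)"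

text \<open>Equality of random variables in the defining recursion is almost sure equality. The values
  \<open>eps 0\<close> and \<open>Z 0 t\<close> are irrelevant.\<close>

definition INAR1 ::
    "'a measure \<Rightarrow> real \<Rightarrow> real \<Rightarrow> (nat \<Rightarrow> 'a \<Rightarrow> nat) \<Rightarrow> (nat \<Rightarrow> 'a \<Rightarrow> nat) \<Rightarrow>
      (nat \<Rightarrow> nat \<Rightarrow> 'a \<Rightarrow> nat) \<Rightarrow> bool" where
  "INAR1 M m r X eps Z \<longleftrightarrow>
    (\<forall>t. X t \<in> measurable M (count_space UNIV)) \<and>
    (\<forall>t\<ge>1. AE \<omega> in M. X t \<omega> = thin Z X (t - 1) \<omega> + eps t \<omega>) \<and>
    (\<forall>t\<ge>1. same_distr M (eps t) (eps 1)) \<and>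
    (\<forall>i\<ge>1. \<forall>t. same_distr M (Z i t) (Z 1 0)) \<and>
    (\<forall>i\<ge>1. \<forall>t. \<forall>s\<in>{0..1}. pgf M (Z i t) s = psi m r s) \<and>
    prob_space.indep_vars M (\<lambda>_. count_space UNIV) (driver_var (X 0) eps Z) drivers"

end

theory Submission
  imports Defs
begin

text \<open>
  Everything rests on one formula, \<open>weighted_pgf_step\<close>: for integrable weights \<open>h (X 0)\<close>,
  \<open>E(h(X 0) s^{X (t+1)}) = E(h(X 0) psi(s)^{X t}) E(s^{eps 1})\<close>.
  It says that, given the past, \<open>X (t + 1)\<close> is a sum of \<open>X t\<close> independent variables with generating
  function \<open>psi\<close>, plus an independent innovation.

  With \<open>t = 0\<close> and \<open>h = 1\<close>, stationarity turns the formula into the functional equation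
  \<open>pgf_X(s) = pgf_X(psi(s)) pgf_eps(s)\<close>. With \<open>t = 0\<close> and \<open>h(x) = s1^x\<close> it gives the joint generating
  function of \<open>X 0\<close> and \<open>X 1\<close>, which is that of \<open>X (t - 1)\<close> and \<open>X t\<close>.

  The moments are read off the functional equation near \<open>s = 1\<close>. What needs an argument is that they are
  finite, since stationarity does not presuppose this. The map \<open>psi\<close> contracts the distance to its fixed point
  1 by a factor of at most \<open>m < 1\<close>. Hence, iterating the functional equation
  (\<open>bounded_by_psi_iteration\<close>), the moments of the innovation bound the first and second difference
  quotients of \<open>pgf_X\<close> at 1, and Fatou's lemma bounds the moments of \<open>X\<close>. After that, the limit at 1
  of the functional equation for the difference quotients yields linear equations for the mean and for
  the second factorial moment.

  With \<open>h(x) = x\<close>, the same limit yields \<open>E(X 0 X (k+1)) = m E(X 0 X k) + E(X 0) E(eps 1)\<close>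
  (\<open>product_moment_step\<close>), so the autocovariances decay geometrically with ratio \<open>m\<close>.
\<close>

section \<open>Difference quotients of powers at 1\<close>

text \<open>The quotient \<open>(1 - s^n) / (1 - s)\<close>, and below it \<open>(n - quot1 n s) / (1 - s)\<close>, written as sums. In this
form they are defined and continuous at \<open>s = 1\<close>, where their values \<open>n\<close> and \<open>n (n - 1) / 2\<close>
are the integrands of the mean and of half the second factorial moment, and on \<open>[0,1]\<close> these
values are also upper bounds.\<close>

definition quot1 :: "nat \<Rightarrow> real \<Rightarrow> real" where
  "quot1 n s = (\<Sum>k<n. s ^ k)"

definition quot2 :: "nat \<Rightarrow> real \<Rightarrow> real" where
  "quot2 n s = (\<Sum>k<n. quot1 k s)"

lemma power_eq_quot1: "s ^ n = 1 - (1 - s) * quot1 n s"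
  using one_diff_power_eq[of s n] by (simp add: quot1_def)

lemma quot1_eq_quot2: "quot1 n s = real n - (1 - s) * quot2 n s"
proof -
  have "quot1 n s = (\<Sum>k<n. 1 - (1 - s) * quot1 k s)"
    unfolding quot1_def[of n] by (simp only: power_eq_quot1[symmetric])
  then show ?thesis
    by (simp add: sum_subtractf sum_distrib_left quot2_def)
qed

lemma quot1_nonneg: "0 \<le> s \<Longrightarrow> 0 \<le> quot1 n s"
  by (simp add: quot1_def sum_nonneg)

lemma quot1_le:
  assumes "0 \<le> s" "s \<le> 1"
  shows "quot1 n s \<le> real n"
  using sum_bounded_above[of "{..<n}" "\<lambda>k. s ^ k" 1] assms
  by (simp add: quot1_def power_le_one)

lemma quot2_nonneg: "0 \<le> s \<Longrightarrow> 0 \<le> quot2 n s"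
  by (simp add: quot2_def sum_nonneg quot1_nonneg)

lemma sum_lessThan_real: "(\<Sum>k<n. real k) = real n * (real n - 1) / 2"
  by (induction n) (auto simp: field_simps)

lemma quot2_le:
  assumes "0 \<le> s" "s \<le> 1"
  shows "quot2 n s \<le> real n * (real n - 1) / 2"
  unfolding quot2_def sum_lessThan_real[symmetric]
  by (intro sum_mono quot1_le assms)

lemma quot1_tendsto:
  assumes "f \<longlonglongrightarrow> 1"
  shows "(\<lambda>j. quot1 n (f j)) \<longlonglongrightarrow> real n"
proof -
  have "(\<lambda>j. \<Sum>k<n. f j ^ k) \<longlonglongrightarrow> (\<Sum>k<n. 1 ^ k)"
    by (intro tendsto_intros assms)
  then show ?thesis
    by (simp add: quot1_def)
qed

lemma quot2_tendsto:
  assumes "f \<longlonglongrightarrow> 1"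
  shows "(\<lambda>j. quot2 n (f j)) \<longlonglongrightarrow> real n * (real n - 1) / 2"
  unfolding quot2_def sum_lessThan_real[symmetric]
  by (intro tendsto_sum quot1_tendsto assms)

section \<open>Generating functions near 1\<close>

text \<open>Left limits at 1 are taken along sequences, because dominated convergence and Fatou's lemma are
statements about sequences. The value 1 is excluded because the quotients at 1 are the integrands
of the moments, whose integrability is to be proved.\<close>

definition approaching_1 :: "(nat \<Rightarrow> real) \<Rightarrow> bool" where
  "approaching_1 f \<longleftrightarrow> (\<forall>j. 0 \<le> f j \<and> f j < 1) \<and> f \<longlonglongrightarrow> 1"

lemma approaching_1_ex: "\<exists>f. approaching_1 f"
proof
  have "(\<lambda>n. 1 - 1 / real (Suc n)) \<longlonglongrightarrow> 1 - 0"
    by (intro tendsto_intros LIMSEQ_inverse_real_of_nat[unfolded inverse_eq_divide])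
  then show "approaching_1 (\<lambda>n. 1 - 1 / real (Suc n))"
    by (simp add: approaching_1_def field_simps)
qed

text \<open>Fatou's lemma in the form that yields moments: finiteness of a moment follows from a uniform bound
on the expected difference quotients, whose limit at 1 is the moment's integrand.\<close>

lemma integrable_bounded_limit:
  fixes f :: "nat \<Rightarrow> 'a \<Rightarrow> real"
  assumes int: "\<And>j. integrable M (f j)" and nonneg: "\<And>j x. 0 \<le> f j x"
    and lim: "\<And>x. (\<lambda>j. f j x) \<longlonglongrightarrow> g x" and bound: "\<And>j. (\<integral>x. f j x \<partial>M) \<le> C"
  shows "integrable M g"
proof (rule integrableI_bounded)
  have [measurable]: "f j \<in> borel_measurable M" for j
    using int by simp
  show "g \<in> borel_measurable M"
    using lim by (rule borel_measurable_LIMSEQ_real) simp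
  have "0 \<le> g x" for x
    using lim[of x] nonneg by (intro LIMSEQ_le_const) auto
  then have "(\<integral>\<^sup>+ x. ennreal (norm (g x)) \<partial>M) = (\<integral>\<^sup>+ x. liminf (\<lambda>j. ennreal (f j x)) \<partial>M)"
    by (intro nn_integral_cong lim_imp_Liminf[symmetric] tendsto_ennrealI)
       (simp_all add: lim)
  also have "\<dots> \<le> liminf (\<lambda>j. \<integral>\<^sup>+ x. ennreal (f j x) \<partial>M)"
    by (intro nn_integral_liminf) simp
  also have "\<dots> \<le> ennreal C"
  proof (intro Liminf_le always_eventually allI)
    show "(\<integral>\<^sup>+ x. ennreal (f j x) \<partial>M) \<le> ennreal C" for j
      using nn_integral_eq_integral[OF int[of j]] nonneg bound[of j] by (simp add: ennreal_leI)
  qed simp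
  finally show "(\<integral>\<^sup>+ x. ennreal (norm (g x)) \<partial>M) < \<infinity>"
    by (simp add: order_le_less_trans)
qed

context prob_space
begin

context
  fixes Y :: "'a \<Rightarrow> nat"
  assumes Y [measurable]: "Y \<in> measurable M (count_space UNIV)"
begin

text \<open>The weight \<open>h\<close> will be 1 for the marginal moments, a power of \<open>s1\<close> for the joint generating
function, and the variable \<open>X 0\<close> itself for the autocovariances.\<close>

lemma integrable_weighted_power:
  fixes h :: "'a \<Rightarrow> real"
  assumes "0 \<le> s" "s \<le> 1" "integrable M h"
  shows "integrable M (\<lambda>x. h x * s ^ Y x)"
  using assms
  by (intro Bochner_Integration.integrable_bound[OF assms(3)])
     (auto simp: abs_mult power_le_one mult_left_le)

lemma integrable_power:
  fixes s :: real
  assumes "0 \<le> s" "s \<le> 1"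
  shows "integrable M (\<lambda>x. s ^ Y x)"
  using integrable_weighted_power[of s "\<lambda>_. 1"] assms by simp

lemma integrable_weighted_quot1:
  assumes s: "0 \<le> s" "s < 1" and h: "integrable M h"
  shows "integrable M (\<lambda>x. h x * quot1 (Y x) s)"
proof -
  have "quot1 (Y x) s = (1 - s ^ Y x) / (1 - s)" for x
    using s by (simp add: power_eq_quot1 field_simps)
  moreover have "integrable M (\<lambda>x. (h x - h x * s ^ Y x) / (1 - s))"
    by (intro integrable_divide Bochner_Integration.integrable_diff integrable_weighted_power)
       (use s h in auto)
  ultimately show ?thesis
    by (simp add: right_diff_distrib)
qed

lemma integral_weighted_power:
  assumes "0 \<le> s" "s < 1" "integrable M h"
  shows "(\<integral>x. h x * s ^ Y x \<partial>M) = (\<integral>x. h x \<partial>M) - (1 - s) * (\<integral>x. h x * quot1 (Y x) s \<partial>M)"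
proof -
  have "h x * s ^ Y x = h x - (1 - s) * (h x * quot1 (Y x) s)" for x
    by (simp only: power_eq_quot1) (simp add: algebra_simps)
  then show ?thesis
    using integrable_weighted_quot1[OF assms] assms by simp
qed

lemma pgf_eq_quot1:
  assumes "0 \<le> s" "s < 1"
  shows "pgf M Y s = 1 - (1 - s) * (\<integral>x. quot1 (Y x) s \<partial>M)"
  using integral_weighted_power[of s "\<lambda>_. 1"] assms by (simp add: pgf_def prob_space)

lemma integrable_quot1:
  assumes "0 \<le> s" "s < 1"
  shows "integrable M (\<lambda>x. quot1 (Y x) s)"
  using integrable_weighted_quot1[of s "\<lambda>_. 1"] assms by simp

lemma integrable_quot2:
  assumes s: "0 \<le> s" "s < 1" and Y1: "integrable M (\<lambda>x. real (Y x))"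
  shows "integrable M (\<lambda>x. quot2 (Y x) s)"
proof -
  have "quot2 (Y x) s = (real (Y x) - quot1 (Y x) s) / (1 - s)" for x
    using s by (simp add: quot1_eq_quot2 field_simps)
  then show ?thesis
    using integrable_quot1[OF s] Y1 by simp
qed

lemma integral_quot1_eq_quot2:
  assumes "0 \<le> s" "s < 1" "integrable M (\<lambda>x. real (Y x))"
  shows "(\<integral>x. quot1 (Y x) s \<partial>M) = mean M Y - (1 - s) * (\<integral>x. quot2 (Y x) s \<partial>M)"
  using integrable_quot2[OF assms] assms by (simp add: quot1_eq_quot2 mean_def)

lemma integral_weighted_quot1_tendsto:
  assumes f: "approaching_1 f" and h: "integrable M h" and hY: "integrable M (\<lambda>x. h x * real (Y x))"
  shows "(\<lambda>j. \<integral>x. h x * quot1 (Y x) (f j) \<partial>M) \<longlonglongrightarrow> (\<integral>x. h x * real (Y x) \<partial>M)"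
proof (rule integral_dominated_convergence[where w = "\<lambda>x. norm (h x * real (Y x))"])
  show "(\<lambda>x. h x * quot1 (Y x) (f j)) \<in> borel_measurable M" for j
    using f integrable_weighted_quot1[OF _ _ h] by (auto simp: approaching_1_def)
  show "AE x in M. (\<lambda>j. h x * quot1 (Y x) (f j)) \<longlonglongrightarrow> h x * real (Y x)"
    using f by (intro AE_I2 tendsto_mult tendsto_const quot1_tendsto) (simp add: approaching_1_def)
  show "AE x in M. norm (h x * quot1 (Y x) (f j)) \<le> norm (h x * real (Y x))" for j
    using f
    by (auto simp: approaching_1_def abs_mult less_imp_le quot1_nonneg intro!: mult_left_mono quot1_le)
qed (use h hY in auto)

lemma integral_quot1_tendsto:
  assumes "approaching_1 f" "integrable M (\<lambda>x. real (Y x))"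
  shows "(\<lambda>j. \<integral>x. quot1 (Y x) (f j) \<partial>M) \<longlonglongrightarrow> mean M Y"
  using integral_weighted_quot1_tendsto[of f "\<lambda>_. 1"] assms by (simp add: mean_def)

lemma integral_quot2_tendsto:
  assumes f: "approaching_1 f" and Y1: "integrable M (\<lambda>x. real (Y x))"
    and Y2: "integrable M (\<lambda>x. real (Y x) * (real (Y x) - 1) / 2)"
  shows "(\<lambda>j. \<integral>x. quot2 (Y x) (f j) \<partial>M) \<longlonglongrightarrow> (\<integral>x. real (Y x) * (real (Y x) - 1) / 2 \<partial>M)"
proof (rule integral_dominated_convergence[where w = "\<lambda>x. real (Y x) * (real (Y x) - 1) / 2"])
  show "(\<lambda>x. quot2 (Y x) (f j)) \<in> borel_measurable M" for j
    using f integrable_quot2[OF _ _ Y1] by (auto simp: approaching_1_def)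
  show "AE x in M. (\<lambda>j. quot2 (Y x) (f j)) \<longlonglongrightarrow> real (Y x) * (real (Y x) - 1) / 2"
    using f by (intro AE_I2 quot2_tendsto) (simp add: approaching_1_def)
  show "AE x in M. norm (quot2 (Y x) (f j)) \<le> real (Y x) * (real (Y x) - 1) / 2" for j
    using f quot2_le by (auto simp: approaching_1_def less_imp_le quot2_nonneg)
qed (use Y2 in auto)

lemma pgf_tendsto_1:
  assumes f: "approaching_1 f"
  shows "(\<lambda>j. pgf M Y (f j)) \<longlonglongrightarrow> 1"
proof -
  have "(\<lambda>j. \<integral>x. f j ^ Y x \<partial>M) \<longlonglongrightarrow> (\<integral>x. 1 \<partial>M)"
  proof (rule integral_dominated_convergence[where w = "\<lambda>_. 1"])
    show "AE x in M. (\<lambda>j. f j ^ Y x) \<longlonglongrightarrow> 1"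
      using f by (auto simp: approaching_1_def intro!: AE_I2 tendsto_eq_intros)
    show "AE x in M. norm (f j ^ Y x) \<le> 1" for j
      using f by (auto simp: approaching_1_def power_le_one less_imp_le intro!: AE_I2)
  qed auto
  then show ?thesis
    by (simp add: pgf_def prob_space)
qed

lemma pgf_nonneg: "0 \<le> s \<Longrightarrow> 0 \<le> pgf M Y s"
  by (simp add: pgf_def)

lemma pgf_le_1:
  assumes "0 \<le> s" "s \<le> 1"
  shows "pgf M Y s \<le> 1"
  using integral_mono[OF integrable_power[OF assms], of "\<lambda>_. 1"] assms
  by (simp add: pgf_def power_le_one prob_space)

lemma pgf_pos:
  assumes "0 < s" "s \<le> 1"
  shows "0 < pgf M Y s"
proof -
  have "pgf M Y s \<noteq> 0"
    using integral_nonneg_eq_0_iff_AE[OF integrable_power, of s] assms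
    by (auto simp: pgf_def AE_False)
  then show ?thesis
    using pgf_nonneg[of s] assms by simp
qed

end

end

section \<open>The generating function of the counting variables\<close>

text \<open>Everything about \<open>psi\<close> is derived from the factor by which it shrinks the distance to 1: this
factor lies between 0 and \<open>m\<close>, and it tends to \<open>m\<close> as \<open>s\<close> approaches 1.\<close>

lemma one_minus_psi: "1 - psi m r s = m / (1 + r * (1 - s)) * (1 - s)"
  by (simp add: psi_def)

lemma thinning_factor:
  assumes "(m, r) \<in> R1" "s \<le> 1"
  shows "0 < m / (1 + r * (1 - s))" "m / (1 + r * (1 - s)) \<le> m"
proof -
  have "0 < m" "1 \<le> 1 + r * (1 - s)"
    using assms by (auto simp: R1_def)
  then show "0 < m / (1 + r * (1 - s))" "m / (1 + r * (1 - s)) \<le> m"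
    by (auto simp: divide_simps mult_le_cancel_left1)
qed

lemma psi_bounds:
  assumes R: "(m, r) \<in> R1" and s: "0 \<le> s" "s \<le> 1"
  shows "0 < psi m r s" "psi m r s \<le> 1" "1 - psi m r s \<le> m * (1 - s)"
proof -
  have m: "0 < m" "m < 1"
    using R by (auto simp: R1_def)
  note w = thinning_factor[OF R s(2)]
  show le: "1 - psi m r s \<le> m * (1 - s)"
    unfolding one_minus_psi using w s by (intro mult_right_mono) auto
  have "m * (1 - s) \<le> m * 1"
    using m s by (intro mult_left_mono) auto
  then show "0 < psi m r s"
    using le m by linarith
  have "0 \<le> 1 - psi m r s"
    unfolding one_minus_psi using w s by (intro mult_nonneg_nonneg) auto
  then show "psi m r s \<le> 1"
    by simp
qed

lemma psi_less_1:
  assumes "(m, r) \<in> R1" "s < 1"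
  shows "psi m r s < 1"
proof -
  have "0 < 1 - psi m r s"
    unfolding one_minus_psi using thinning_factor(1)[of m r s] assms
    by (intro mult_pos_pos) auto
  then show ?thesis
    by simp
qed

lemma approaching_1_psi:
  assumes R: "(m, r) \<in> R1" and f: "approaching_1 f"
  shows "approaching_1 (\<lambda>j. psi m r (f j))"
  unfolding approaching_1_def
proof (intro conjI allI)
  show "0 \<le> psi m r (f j)" "psi m r (f j) < 1" for j
    using f psi_bounds[OF R, of "f j"] psi_less_1[OF R, of "f j"]
    by (auto simp: approaching_1_def less_imp_le)
  have "f \<longlonglongrightarrow> 1"
    using f by (simp add: approaching_1_def)
  then show "(\<lambda>j. psi m r (f j)) \<longlonglongrightarrow> 1"
    unfolding psi_def by (auto intro!: tendsto_eq_intros)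
qed

lemma thinning_factor_tendsto:
  assumes "approaching_1 f"
  shows "(\<lambda>j. m / (1 + r * (1 - f j))) \<longlonglongrightarrow> m"
  using assms by (auto simp: approaching_1_def intro!: tendsto_eq_intros)

text \<open>Iterating \<open>psi\<close> moves every point of \<open>[0,1)\<close> to 1 at least geometrically, \<open>1 - psi^n(s) \<le> m^n (1 - s)\<close>.
Applying the hypothesis \<open>n\<close> times, the error terms add up to a geometric series with ratio \<open>m^p\<close>,
and the remainder \<open>f (psi^n(s))\<close> vanishes in the limit. So a one-step estimate of order \<open>(1 - s)^p\<close>
becomes a bound of the same order.\<close>

lemma bounded_by_psi_iteration:
  assumes R: "(m, r) \<in> R1" and p: "0 < p" and C: "0 \<le> C"
    and step: "\<And>s. 0 \<le> s \<Longrightarrow> s < 1 \<Longrightarrow> f s \<le> f (psi m r s) + C * (1 - s) ^ p"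
    and lim: "\<And>g. approaching_1 g \<Longrightarrow> (\<lambda>j. f (g j)) \<longlonglongrightarrow> 0"
    and s: "0 \<le> s" "s < 1"
  shows "f s \<le> C / (1 - m ^ p) * (1 - s) ^ p"
proof -
  have m: "0 < m" "m < 1"
    using R by (auto simp: R1_def)
  have q: "0 \<le> m ^ p" "m ^ p < 1"
    using m p by (auto simp: power_less_one_iff)
  let ?g = "\<lambda>n. (psi m r ^^ n) s"
  have g: "0 \<le> ?g n \<and> ?g n < 1 \<and> 1 - ?g n \<le> m ^ n * (1 - s)" for n
  proof (induction n)
    case 0
    then show ?case
      using s by simp
  next
    case (Suc n)
    have "1 - psi m r (?g n) \<le> m * (m ^ n * (1 - s))"
      using psi_bounds(3)[OF R, of "?g n"] Suc m
      by (smt (verit) mult_left_mono)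
    then show ?case
      using Suc psi_bounds[OF R, of "?g n"] psi_less_1[OF R, of "?g n"] by simp
  qed
  have "?g \<longlonglongrightarrow> 1"
  proof (rule tendsto_sandwich)
    show "\<forall>\<^sub>F n in sequentially. 1 - m ^ n * (1 - s) \<le> ?g n"
      using g by (intro always_eventually allI) (smt (verit))
    show "\<forall>\<^sub>F n in sequentially. ?g n \<le> 1"
      using g by (auto simp: less_imp_le)
    show "(\<lambda>n. 1 - m ^ n * (1 - s)) \<longlonglongrightarrow> 1"
      using m by (auto intro!: tendsto_eq_intros LIMSEQ_realpow_zero)
  qed simp
  then have "approaching_1 ?g"
    using g by (simp add: approaching_1_def)
  have bound: "f s \<le> f (?g n) + C / (1 - m ^ p) * (1 - s) ^ p * (1 - (m ^ p) ^ n)" for n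
  proof (induction n)
    case 0
    then show ?case
      by simp
  next
    case (Suc n)
    have "(1 - ?g n) ^ p \<le> (m ^ n * (1 - s)) ^ p"
      using g[of n] by (intro power_mono) auto
    then have "C * (1 - ?g n) ^ p \<le> C * ((m ^ p) ^ n * (1 - s) ^ p)"
      using C by (intro mult_left_mono) (auto simp: power_mult_distrib power_mult[symmetric] mult.commute)
    also have "\<dots> = C / (1 - m ^ p) * (1 - s) ^ p * ((1 - (m ^ p) ^ Suc n) - (1 - (m ^ p) ^ n))"
      using q by (simp add: field_simps)
    finally show ?case
      using Suc step[of "?g n"] g[of n] by (simp add: right_diff_distrib)
  qed
  have "(\<lambda>n. f (?g n) + C / (1 - m ^ p) * (1 - s) ^ p * (1 - (m ^ p) ^ n)) \<longlonglongrightarrow>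
    0 + C / (1 - m ^ p) * (1 - s) ^ p * (1 - 0)"
    by (intro tendsto_intros lim LIMSEQ_realpow_zero q \<open>approaching_1 ?g\<close>)
  then show ?thesis
    using bound by (intro LIMSEQ_le_const) auto
qed

section \<open>Moments of a solution of the functional equation\<close>

text \<open>The functional equation in terms of difference quotients. Here \<open>u = 1 - s\<close>, \<open>w u = 1 - psi(s)\<close>, \<open>E\<close> is the
generating function of the innovation, and \<open>a\<close>, \<open>b\<close>, \<open>c\<close> are the expected first quotients of the
solution at \<open>s\<close>, of the solution at \<open>psi(s)\<close>, and of the innovation. The total mass \<open>c0\<close> is 1 for a
generating function, and the expected weight in the weighted case. Dividing by \<open>u\<close> leaves an
identity in which the limit at 1 can be taken termwise.\<close>

lemma first_difference_quotient:
  fixes a b c c0 u w E :: real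
  assumes "c0 - u * a = (c0 - w * u * b) * E" "E = 1 - u * c" "u \<noteq> 0"
  shows "a = w * b * E + c0 * c"
proof -
  have "u * a = c0 - c0 * E + u * (w * b * E)"
    using assms(1) by (simp add: algebra_simps)
  also have "c0 - c0 * E = u * (c0 * c)"
    by (simp add: assms(2) algebra_simps)
  finally have "u * a = u * (w * b * E + c0 * c)"
    by (simp add: algebra_simps)
  then show ?thesis
    using assms(3) by simp
qed

text \<open>The same division carried out once more; now \<open>a\<close>, \<open>b\<close>, \<open>c\<close> are second quotients and \<open>\<mu>\<close>, \<open>\<mu>'\<close> the means.
By the relation between the means, the terms without a factor \<open>u\<close> cancel up to \<open>(m - w) \<mu> = r u w \<mu>\<close>,
which has this factor; so the curvature of \<open>psi\<close> at 1 brings in the parameter \<open>r\<close>.\<close>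

lemma second_difference_quotient:
  fixes a b c u w E m r \<mu> \<mu>' :: real
  assumes "\<mu> - u * a = w * (\<mu> - w * u * b) * E + (\<mu>' - u * c)"
    and "E = 1 - u * (\<mu>' - u * c)" "u \<noteq> 0" "w * (1 + r * u) = m" "\<mu> = m * \<mu> + \<mu>'"
  shows "a = w\<^sup>2 * b * E + (c + r * w * \<mu> + w * \<mu> * (\<mu>' - u * c))"
proof -
  have "u * a = \<mu> - \<mu>' - w * \<mu> * E + w * w * u * b * E + u * c"
    using assms(1) by (simp add: algebra_simps)
  also have "\<mu> - \<mu>' = w * (1 + r * u) * \<mu>"
    using assms(4,5) by simp
  also have "w * (1 + r * u) * \<mu> - w * \<mu> * E = u * (r * w * \<mu> + w * \<mu> * (\<mu>' - u * c))"
    by (simp add: assms(2) algebra_simps)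
  finally have "u * a = u * (w\<^sup>2 * b * E + (c + r * w * \<mu> + w * \<mu> * (\<mu>' - u * c)))"
    by (simp add: algebra_simps power2_eq_square)
  then show ?thesis
    using assms(3) by simp
qed

context prob_space
begin

context
  fixes X e :: "'a \<Rightarrow> nat" and m r :: real
  assumes X [measurable]: "X \<in> measurable M (count_space UNIV)"
    and e [measurable]: "e \<in> measurable M (count_space UNIV)"
    and R: "(m, r) \<in> R1"
    and pgf_eq: "\<And>s. 0 \<le> s \<Longrightarrow> s < 1 \<Longrightarrow> pgf M X s = pgf M X (psi m r s) * pgf M e s"
    and e1: "integrable M (\<lambda>x. real (e x))"
begin

lemma m_bounds: "0 < m" "m < 1" "0 \<le> r"
  using R by (auto simp: R1_def)

lemma integral_quot1_step:
  assumes s: "0 \<le> s" "s < 1"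
  shows "(\<integral>x. quot1 (X x) s \<partial>M) =
    m / (1 + r * (1 - s)) * (\<integral>x. quot1 (X x) (psi m r s) \<partial>M) * pgf M e s + (\<integral>x. quot1 (e x) s \<partial>M)"
proof -
  have psi: "0 \<le> psi m r s" "psi m r s < 1"
    using psi_bounds[OF R, of s] psi_less_1[OF R, of s] s by auto
  show ?thesis
    using first_difference_quotient[of 1 "1 - s" "\<integral>x. quot1 (X x) s \<partial>M" "m / (1 + r * (1 - s))"
        "\<integral>x. quot1 (X x) (psi m r s) \<partial>M" "pgf M e s" "\<integral>x. quot1 (e x) s \<partial>M"]
      pgf_eq_quot1[OF X s] pgf_eq_quot1[OF X psi] pgf_eq_quot1[OF e s] pgf_eq[OF s] s
    by (simp only: one_minus_psi) simp
qed

lemma integral_quot1_le_mean: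
  assumes "0 \<le> s" "s < 1"
  shows "(\<integral>x. quot1 (e x) s \<partial>M) \<le> mean M e"
  unfolding mean_def using assms e1 by (intro integral_mono integrable_quot1 quot1_le) auto

text \<open>Stationarity alone does not say that \<open>X\<close> has a mean. The defect \<open>f(s) = 1 - pgf M X s\<close> satisfies
\<open>f(s) \<le> f(psi(s)) + mean(e) (1 - s)\<close>, because \<open>1 - a b \<le> (1 - a) + (1 - b)\<close> on \<open>[0,1]\<close>. Iteration bounds
\<open>f(s) / (1 - s)\<close>, the expected first quotient, and Fatou's lemma gives the mean.\<close>

lemma solution_integrable: "integrable M (\<lambda>x. real (X x))"
proof -
  obtain g where g: "approaching_1 g"
    using approaching_1_ex by blast
  have mean_nonneg: "0 \<le> mean M e"
    by (simp add: mean_def)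
  have "(1 - pgf M X s) \<le> mean M e / (1 - m ^ 1) * (1 - s) ^ 1" if s: "0 \<le> s" "s < 1" for s
  proof (rule bounded_by_psi_iteration[OF R, where f = "\<lambda>s. 1 - pgf M X s"])
    fix s :: real assume s: "0 \<le> s" "s < 1"
    have psi: "0 \<le> psi m r s" "psi m r s \<le> 1"
      using psi_bounds[OF R, of s] s by auto
    have "pgf M X (psi m r s) * (1 - pgf M e s) \<le> 1 * (1 - pgf M e s)"
      using psi s by (intro mult_right_mono pgf_le_1 X) (auto intro: pgf_le_1)
    moreover have "1 - pgf M e s \<le> mean M e * (1 - s)"
      using integral_quot1_le_mean[OF s] s by (simp add: pgf_eq_quot1 mult.commute mult_right_mono)
    ultimately show "1 - pgf M X s \<le> 1 - pgf M X (psi m r s) + mean M e * (1 - s) ^ 1"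
      using pgf_eq[OF s] by (simp add: algebra_simps)
  next
    fix g assume "approaching_1 g"
    then have "(\<lambda>j. 1 - pgf M X (g j)) \<longlonglongrightarrow> 1 - 1"
      by (intro tendsto_intros pgf_tendsto_1 X)
    then show "(\<lambda>j. 1 - pgf M X (g j)) \<longlonglongrightarrow> 0"
      by simp
  qed (use mean_nonneg s in auto)
  note bound = this
  have "(\<integral>x. quot1 (X x) s \<partial>M) \<le> mean M e / (1 - m)" if s: "0 \<le> s" "s < 1" for s
  proof -
    have "(1 - s) * (\<integral>x. quot1 (X x) s \<partial>M) \<le> (1 - s) * (mean M e / (1 - m))"
      using bound[OF s] pgf_eq_quot1[OF X s] by (simp add: mult.commute)
    then show ?thesis
      by (rule mult_left_le_imp_le) (use s in simp)
  qed
  note quot1_bound = this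
  have g01: "0 \<le> g j" "g j < 1" "g \<longlonglongrightarrow> 1" for j
    using g by (auto simp: approaching_1_def)
  show ?thesis
    by (rule integrable_bounded_limit[where f = "\<lambda>j x. quot1 (X x) (g j)"])
       (rule integrable_quot1 quot1_nonneg quot1_tendsto quot1_bound X g01)+
qed

lemma solution_mean: "mean M X = m * mean M X + mean M e"
proof -
  obtain g where g: "approaching_1 g"
    using approaching_1_ex by blast
  have g01: "0 \<le> g j" "g j < 1" for j
    using g by (auto simp: approaching_1_def)
  have lim: "(\<lambda>j. m / (1 + r * (1 - g j)) * (\<integral>x. quot1 (X x) (psi m r (g j)) \<partial>M) * pgf M e (g j)
      + (\<integral>x. quot1 (e x) (g j) \<partial>M)) \<longlonglongrightarrow> m * mean M X * 1 + mean M e"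
    by (intro tendsto_intros thinning_factor_tendsto integral_quot1_tendsto approaching_1_psi
          pgf_tendsto_1 X e R g e1 solution_integrable)
  have "(\<lambda>j. \<integral>x. quot1 (X x) (g j) \<partial>M) \<longlonglongrightarrow> mean M X"
    by (intro integral_quot1_tendsto X g solution_integrable)
  from LIMSEQ_unique[OF this[unfolded integral_quot1_step[OF g01]] lim] show ?thesis
    by (simp only: mult_1_right)
qed

lemma integral_quot2_step:
  assumes s: "0 \<le> s" "s < 1"
  shows "(\<integral>x. quot2 (X x) s \<partial>M) =
    (m / (1 + r * (1 - s)))\<^sup>2 * (\<integral>x. quot2 (X x) (psi m r s) \<partial>M) * pgf M e s +
    ((\<integral>x. quot2 (e x) s \<partial>M) + r * (m / (1 + r * (1 - s))) * mean M X +
     m / (1 + r * (1 - s)) * mean M X * (\<integral>x. quot1 (e x) s \<partial>M))"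
proof -
  have psi: "0 \<le> psi m r s" "psi m r s < 1"
    using psi_bounds[OF R, of s] psi_less_1[OF R, of s] s by auto
  have "0 < 1 + r * (1 - s)"
    using m_bounds s by (intro add_pos_nonneg) auto
  then have w: "m / (1 + r * (1 - s)) * (1 + r * (1 - s)) = m"
    by simp
  note e_eq = integral_quot1_eq_quot2[OF e s e1]
  show ?thesis
    unfolding e_eq
  proof (rule second_difference_quotient[OF _ _ _ w solution_mean])
    show "mean M X - (1 - s) * (\<integral>x. quot2 (X x) s \<partial>M) =
        m / (1 + r * (1 - s)) *
        (mean M X - m / (1 + r * (1 - s)) * (1 - s) * (\<integral>x. quot2 (X x) (psi m r s) \<partial>M)) * pgf M e s +
        (mean M e - (1 - s) * (\<integral>x. quot2 (e x) s \<partial>M))"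
      using integral_quot1_step[OF s] e_eq integral_quot1_eq_quot2[OF X s solution_integrable]
        integral_quot1_eq_quot2[OF X psi solution_integrable]
      by (simp only: one_minus_psi)
    show "pgf M e s = 1 - (1 - s) * (mean M e - (1 - s) * (\<integral>x. quot2 (e x) s \<partial>M))"
      using pgf_eq_quot1[OF e s] e_eq by simp
  qed (use s in simp)
qed

context
  assumes e2: "integrable M (\<lambda>x. real (e x) * (real (e x) - 1) / 2)"
begin

text \<open>The argument for the mean, one order higher: the remainder of the first-order expansion of the
generating function at 1 equals \<open>(1 - s)^2\<close> times the expected second quotient. Multiplied by
\<open>(1 - s)^2\<close>, the identity for second quotients bounds the remainder at \<open>s\<close> by the one at \<open>psi(s)\<close> plus an
error of order \<open>(1 - s)^2\<close>.\<close>

lemma solution_integrable_factorial_moment: "integrable M (\<lambda>x. real (X x) * (real (X x) - 1) / 2)"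
proof -
  obtain g where g: "approaching_1 g"
    using approaching_1_ex by blast
  note X1 = solution_integrable
  let ?q = "\<integral>x. real (e x) * (real (e x) - 1) / 2 \<partial>M"
  let ?C = "?q + r * m * mean M X + m * mean M X * mean M e"
  have mean_nonneg: "0 \<le> mean M e" "0 \<le> mean M X"
    by (simp_all add: mean_def)
  have "0 \<le> real n * (real n - 1) / 2" for n
    using order_trans[OF quot2_nonneg quot2_le, of 0 n] by simp
  then have "0 \<le> ?q"
    by (intro integral_nonneg_AE AE_I2) blast
  then have C: "0 \<le> ?C"
    using mean_nonneg m_bounds by (intro add_nonneg_nonneg mult_nonneg_nonneg) auto
  let ?f = "\<lambda>s. pgf M X s - 1 + (1 - s) * mean M X"
  have f_eq: "?f s = (1 - s)\<^sup>2 * (\<integral>x. quot2 (X x) s \<partial>M)" if s: "0 \<le> s" "s < 1" for s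
    by (simp add: pgf_eq_quot1[OF X s] integral_quot1_eq_quot2[OF X s X1] algebra_simps power2_eq_square)
  have "?f s \<le> ?C / (1 - m\<^sup>2) * (1 - s)\<^sup>2" if s: "0 \<le> s" "s < 1" for s
  proof (rule bounded_by_psi_iteration[OF R, where f = ?f])
    fix s :: real assume s: "0 \<le> s" "s < 1"
    have psi: "0 \<le> psi m r s" "psi m r s < 1"
      using psi_bounds[OF R, of s] psi_less_1[OF R, of s] s by auto
    let ?w = "m / (1 + r * (1 - s))"
    have w: "0 \<le> ?w" "?w \<le> m"
      using thinning_factor[OF R, of s] s by auto
    let ?D = "\<integral>x. quot2 (X x) (psi m r s) \<partial>M"
    have D: "0 \<le> ?D"
      using psi by (intro integral_nonneg_AE AE_I2 quot2_nonneg) auto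
    have "?w\<^sup>2 * ?D * pgf M e s \<le> ?w\<^sup>2 * ?D"
      using D s by (intro mult_left_le pgf_le_1 e) auto
    moreover have "(\<integral>x. quot2 (e x) s \<partial>M) \<le> ?q"
      using s by (intro integral_mono integrable_quot2 quot2_le e e1 e2) auto
    moreover have "r * ?w * mean M X \<le> r * m * mean M X"
      using m_bounds mean_nonneg w by (intro mult_right_mono mult_left_mono) auto
    moreover have "?w * mean M X * (\<integral>x. quot1 (e x) s \<partial>M) \<le> m * mean M X * mean M e"
      using mean_nonneg w s m_bounds
      by (intro mult_mono integral_quot1_le_mean integral_nonneg_AE AE_I2 quot1_nonneg) auto
    ultimately have "(\<integral>x. quot2 (X x) s \<partial>M) \<le> ?w\<^sup>2 * ?D + ?C"
      using integral_quot2_step[OF s] by linarith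
    then have "(1 - s)\<^sup>2 * (\<integral>x. quot2 (X x) s \<partial>M) \<le> (1 - s)\<^sup>2 * (?w\<^sup>2 * ?D + ?C)"
      by (intro mult_left_mono) auto
    then have "?f s \<le> (?w * (1 - s))\<^sup>2 * ?D + ?C * (1 - s)\<^sup>2"
      unfolding f_eq[OF s] by (simp only: distrib_left power_mult_distrib ac_simps)
    then show "?f s \<le> ?f (psi m r s) + ?C * (1 - s)\<^sup>2"
      unfolding f_eq[OF psi] by (simp only: one_minus_psi)
  next
    fix g assume g: "approaching_1 g"
    then have "(\<lambda>j. ?f (g j)) \<longlonglongrightarrow> 1 - 1 + (1 - 1) * mean M X"
      by (intro tendsto_intros pgf_tendsto_1 X) (auto simp: approaching_1_def)
    then show "(\<lambda>j. ?f (g j)) \<longlonglongrightarrow> 0"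
      by simp
  qed (use C s in auto)
  note bound = this
  have "(\<integral>x. quot2 (X x) s \<partial>M) \<le> ?C / (1 - m\<^sup>2)" if s: "0 \<le> s" "s < 1" for s
  proof -
    have "(1 - s)\<^sup>2 * (\<integral>x. quot2 (X x) s \<partial>M) = ?f s"
      by (rule f_eq[OF s, symmetric])
    also have "\<dots> \<le> ?C / (1 - m\<^sup>2) * (1 - s)\<^sup>2"
      by (rule bound[OF s])
    also have "\<dots> = (1 - s)\<^sup>2 * (?C / (1 - m\<^sup>2))"
      by (rule mult.commute)
    finally show ?thesis
      by (rule mult_left_le_imp_le) (use s in simp)
  qed
  note quot2_bound = this
  have g01: "0 \<le> g j" "g j < 1" "g \<longlonglongrightarrow> 1" for j
    using g by (auto simp: approaching_1_def)
  show ?thesis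
    by (rule integrable_bounded_limit[where f = "\<lambda>j x. quot2 (X x) (g j)"])
       (rule integrable_quot2 quot2_nonneg quot2_tendsto quot2_bound X X1 g01)+
qed

lemma solution_factorial_moment:
  "(\<integral>x. real (X x) * (real (X x) - 1) / 2 \<partial>M) =
     m\<^sup>2 * (\<integral>x. real (X x) * (real (X x) - 1) / 2 \<partial>M) +
     ((\<integral>x. real (e x) * (real (e x) - 1) / 2 \<partial>M) + r * m * mean M X + m * mean M X * mean M e)"
proof -
  obtain g where g: "approaching_1 g"
    using approaching_1_ex by blast
  let ?qX = "\<integral>x. real (X x) * (real (X x) - 1) / 2 \<partial>M"
  let ?qe = "\<integral>x. real (e x) * (real (e x) - 1) / 2 \<partial>M"
  have g01: "0 \<le> g j" "g j < 1" for j
    using g by (auto simp: approaching_1_def)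
  have lim: "(\<lambda>j. (m / (1 + r * (1 - g j)))\<^sup>2 * (\<integral>x. quot2 (X x) (psi m r (g j)) \<partial>M) * pgf M e (g j) +
    ((\<integral>x. quot2 (e x) (g j) \<partial>M) + r * (m / (1 + r * (1 - g j))) * mean M X +
     m / (1 + r * (1 - g j)) * mean M X * (\<integral>x. quot1 (e x) (g j) \<partial>M)))
    \<longlonglongrightarrow> m\<^sup>2 * ?qX * 1 + (?qe + r * m * mean M X + m * mean M X * mean M e)"
    by (intro tendsto_intros thinning_factor_tendsto integral_quot1_tendsto integral_quot2_tendsto
          approaching_1_psi pgf_tendsto_1 X e R g e1 e2 solution_integrable solution_integrable_factorial_moment)
  have "(\<lambda>j. \<integral>x. quot2 (X x) (g j) \<partial>M) \<longlonglongrightarrow> ?qX"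
    by (intro integral_quot2_tendsto X g solution_integrable solution_integrable_factorial_moment)
  from LIMSEQ_unique[OF this[unfolded integral_quot2_step[OF g01]] lim] show ?thesis
    by (simp only: mult_1_right)
qed

end

end

end

section \<open>The recursion and the independent drivers\<close>

text \<open>The process is given by its recursion only up to null sets. This is the exact solution as a function
of the values of all drivers, so that independence of \<open>X 0, ..., X t\<close> from later drivers becomes the
fact that \<open>trajectory t\<close> reads no driver outside \<open>past t\<close>.\<close>

fun trajectory :: "nat \<Rightarrow> (driver \<Rightarrow> nat) \<Rightarrow> nat" where
  "trajectory 0 v = v Init"
| "trajectory (Suc t) v = (\<Sum>i = 1..trajectory t v. v (Count i t)) + v (Innov (Suc t))"

definition past :: "nat \<Rightarrow> driver set" where
  "past t = {Init} \<union> {Innov j |j. 1 \<le> j \<and> j \<le> t} \<union> {Count i j |i j. 1 \<le> i \<and> j < t}"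

lemma past_mono: "past t \<subseteq> past (Suc t)"
  by (auto simp: past_def)

lemma trajectory_restrict:
  "past t \<subseteq> A \<Longrightarrow> trajectory t (restrict v A) = trajectory t v"
proof (induction t)
  case 0
  then show ?case
    by (auto simp: past_def)
next
  case (Suc t)
  have "Innov (Suc t) \<in> A" "Count i t \<in> A" if "1 \<le> i" for i
    using Suc.prems that by (auto simp: past_def)
  moreover have "Innov (Suc t) \<in> A"
    using Suc.prems by (auto simp: past_def)
  ultimately show ?case
    using Suc.IH Suc.prems past_mono[of t] by simp
qed

lemma measurable_nat_add:
  fixes f g :: "'a \<Rightarrow> nat"
  assumes [measurable]: "f \<in> measurable M (count_space UNIV)" "g \<in> measurable M (count_space UNIV)"
  shows "(\<lambda>x. f x + g x) \<in> measurable M (count_space UNIV)"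
  by measurable

lemma measurable_nat_sum:
  fixes f :: "'i \<Rightarrow> 'a \<Rightarrow> nat"
  assumes "\<And>i. i \<in> I \<Longrightarrow> f i \<in> measurable M (count_space UNIV)"
  shows "(\<lambda>x. \<Sum>i\<in>I. f i x) \<in> measurable M (count_space UNIV)"
  using assms
proof (induction I rule: infinite_finite_induct)
  case (insert i I)
  then show ?case
    by (simp add: measurable_nat_add)
qed auto

lemma trajectory_measurable:
  "past t \<subseteq> A \<Longrightarrow> trajectory t \<in> measurable (PiM A (\<lambda>_. count_space UNIV)) (count_space UNIV)"
proof (induction t)
  case 0
  then have "Init \<in> A"
    by (auto simp: past_def)
  then show ?case
    by (simp add: measurable_component_singleton cong: measurable_cong)
next
  case (Suc t)
  have comp: "(\<lambda>v. v d :: nat) \<in> measurable (PiM A (\<lambda>_. count_space UNIV)) (count_space UNIV)"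
    if "d \<in> past (Suc t)" for d :: driver
    using Suc.prems that by (intro measurable_component_singleton) auto
  have "(\<lambda>v. (\<Sum>i = 1..n. v (Count i t)) + v (Innov (Suc t)) :: nat)
      \<in> measurable (PiM A (\<lambda>_. count_space UNIV)) (count_space UNIV)" for n
    by (intro measurable_nat_add measurable_nat_sum comp) (auto simp: past_def)
  then show ?case
    unfolding trajectory.simps
    by (rule measurable_compose_countable[where g = "trajectory t" and
          f = "\<lambda>n v. (\<Sum>i = 1..n. v (Count i t)) + v (Innov (Suc t))"]) (use Suc past_mono[of t] in auto)
qed

context prob_space
begin

lemma integral_sum_over_values:
  fixes f :: "'a \<Rightarrow> real" and N :: "'a \<Rightarrow> nat"
  assumes [measurable]: "N \<in> measurable M (count_space UNIV)" and f: "integrable M f"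
  shows "(\<integral>x. f x \<partial>M) = (\<Sum>n. \<integral>x. f x * of_bool (N x = n) \<partial>M)"
proof -
  let ?A = "\<lambda>n. {x \<in> space M. N x = n}"
  have U: "(\<Union>n. ?A n) = space M"
    by auto
  have "(LINT x:(\<Union>n. ?A n)|M. f x) = (\<Sum>n. LINT x:?A n|M. f x)"
    by (intro lebesgue_integral_countable_add)
       (auto simp: U set_integrable_def f intro: integrable_mult_indicator[of "space M" M f, simplified])
  moreover have "(LINT x:?A n|M. f x) = (\<integral>x. f x * of_bool (N x = n) \<partial>M)" for n
    unfolding set_lebesgue_integral_def
    by (intro Bochner_Integration.integral_cong) (auto simp: indicator_def)
  moreover have "(LINT x:(\<Union>n. ?A n)|M. f x) = (\<integral>x. f x \<partial>M)"
    unfolding U by (simp add: set_integral_space f)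
  ultimately show ?thesis
    by simp
qed

context
  fixes m r :: real and X eps :: "nat \<Rightarrow> 'a \<Rightarrow> nat" and Z :: "nat \<Rightarrow> nat \<Rightarrow> 'a \<Rightarrow> nat"
  assumes INAR: "INAR1 M m r X eps Z"
begin

abbreviation (input) V :: "driver \<Rightarrow> 'a \<Rightarrow> nat" where
  "V \<equiv> driver_var (X 0) eps Z"

lemma X_measurable [measurable]: "X t \<in> measurable M (count_space UNIV)"
  using INAR by (simp add: INAR1_def)

lemma drivers_indep: "indep_vars (\<lambda>_. count_space UNIV) V drivers"
  using INAR by (simp add: INAR1_def)

lemma driver_measurable: "d \<in> drivers \<Longrightarrow> V d \<in> measurable M (count_space UNIV)"
  using drivers_indep by (simp add: indep_vars_def)

lemma eps_measurable: "1 \<le> t \<Longrightarrow> eps t \<in> measurable M (count_space UNIV)"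
  using driver_measurable[of "Innov t"] by (simp add: drivers_def)

lemma past_subset_drivers: "past t \<subseteq> drivers"
  by (auto simp: past_def drivers_def)

lemma trajectory_V_measurable: "(\<lambda>x. trajectory t (\<lambda>d. V d x)) \<in> measurable M (count_space UNIV)"
proof -
  have "(\<lambda>x. \<lambda>d\<in>drivers. V d x) \<in> measurable M (PiM drivers (\<lambda>_. count_space UNIV))"
    by (intro measurable_restrict driver_measurable)
  from measurable_compose[OF this trajectory_measurable[OF past_subset_drivers]]
  show ?thesis
    by (simp add: trajectory_restrict past_subset_drivers)
qed

lemma AE_X_eq_trajectory: "AE x in M. X t x = trajectory t (\<lambda>d. V d x)"
proof (induction t)
  case (Suc t)
  have "AE x in M. X (Suc t) x = thin Z X t x + eps (Suc t) x"
    using INAR unfolding INAR1_def by (metis diff_Suc_1 le_add1 plus_1_eq_Suc)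
  then show ?case
    using Suc by eventually_elim (simp add: thin_def)
qed simp

lemma pgf_eps: "pgf M (eps (Suc t)) s = pgf M (eps 1) s"
proof -
  have "distr M (count_space UNIV) (eps (Suc t)) = distr M (count_space UNIV) (eps 1)"
    using INAR unfolding INAR1_def same_distr_def by (metis le_add1 plus_1_eq_Suc)
  then have "(\<integral>n. s ^ n \<partial>distr M (count_space UNIV) (eps (Suc t))) =
      (\<integral>n. s ^ n \<partial>distr M (count_space UNIV) (eps 1))"
    by simp
  then show ?thesis
    by (simp add: pgf_def integral_distr eps_measurable)
qed

text \<open>On the event that the process has the value \<open>n\<close> at time \<open>t\<close>, the random sum in the recursion has \<open>n\<close> terms, so
the integrand is a product of \<open>n + 2\<close> independent factors: one that depends on the past, \<open>n\<close> powers with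
counting variables as exponents, and one with the innovation as exponent.\<close>

lemma expectation_given_value:
  fixes h :: "nat \<Rightarrow> real"
  assumes h: "integrable M (\<lambda>x. h (X 0 x))" and s: "0 \<le> s" "s \<le> 1"
  defines "T \<equiv> \<lambda>t x. trajectory t (\<lambda>d. V d x)"
  shows "(\<integral>x. h (X 0 x) * s ^ T (Suc t) x * of_bool (T t x = n) \<partial>M) =
    (\<integral>x. h (X 0 x) * of_bool (T t x = n) \<partial>M) * (psi m r s ^ n * pgf M (eps 1) s)"
proof -
  define C where "C = (\<lambda>i. Count i t) ` {1..n}"
  (* The index Init represents the whole past; all other blocks K d are singletons. *)
  define L where "L = insert Init (insert (Innov (Suc t)) C)"
  define K where "K d = (if d = Init then past t else {d})" for d
  define G :: "driver \<Rightarrow> (driver \<Rightarrow> nat) \<Rightarrow> real" where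
    "G d v = (if d = Init then h (v Init) * of_bool (trajectory t v = n) else s ^ v d)" for d v
  let ?G = "\<lambda>d x. G d (restrict (\<lambda>i. V i x) (K d))"
  have C: "finite C" "Init \<notin> C" "Innov (Suc t) \<notin> C"
    by (auto simp: C_def)
  have "indep_vars (\<lambda>d. PiM (K d) (\<lambda>_. count_space UNIV))
      (\<lambda>d x. restrict (\<lambda>i. V i x) (K d)) L"
  proof (rule indep_vars_restrict[OF drivers_indep])
    show "K d \<subseteq> drivers" if "d \<in> L" for d
      using that by (auto simp: L_def K_def C_def past_subset_drivers drivers_def past_def)
    show "disjoint_family_on K L"
      by (auto simp: disjoint_family_on_def L_def K_def C_def past_def)
  qed
  then have "indep_vars (\<lambda>_. borel) ?G L"
  proof (rule indep_vars_compose2)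
    fix d :: driver
    have Init: "(\<lambda>v. h (v Init) * of_bool (trajectory t v = n))
        \<in> borel_measurable (PiM (past t) (\<lambda>_. count_space UNIV))"
    proof -
      have [measurable]: "trajectory t \<in> measurable (PiM (past t) (\<lambda>_. count_space UNIV)) (count_space UNIV)"
        by (rule trajectory_measurable) simp
      have [measurable]: "(\<lambda>v. v Init) \<in> measurable (PiM (past t) (\<lambda>_. count_space UNIV)) (count_space UNIV)"
        by (rule measurable_component_singleton) (simp add: past_def)
      show ?thesis
        by measurable
    qed
    moreover have "(\<lambda>v. s ^ v d) \<in> borel_measurable (PiM {d} (\<lambda>_. count_space UNIV))"
      by (rule measurable_compose[OF measurable_component_singleton]) auto
    ultimately show "G d \<in> borel_measurable (PiM (K d) (\<lambda>_. count_space UNIV))"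
      by (cases "d = Init") (simp_all add: G_def[abs_def] K_def)
  qed
  moreover have G_Init: "?G Init x = h (X 0 x) * of_bool (T t x = n)" for x
    by (simp add: G_def K_def trajectory_restrict T_def) (simp add: past_def)
  moreover have G_other: "?G d x = s ^ V d x" if "d \<noteq> Init" for d x
    using that by (simp add: G_def K_def)
  moreover have [measurable]: "T t \<in> measurable M (count_space UNIV)"
    unfolding T_def by (rule trajectory_V_measurable)
  have "integrable M (?G d)" if "d \<in> L" for d
  proof (cases "d = Init")
    case True
    have "integrable M (\<lambda>x. h (X 0 x) * of_bool (T t x = n))"
      by (rule Bochner_Integration.integrable_bound[OF h]) auto
    then show ?thesis
      by (simp add: True G_Init)
  next
    case False
    have "d \<in> drivers"
      using that False by (auto simp: L_def C_def drivers_def)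
    then show ?thesis
      using False s by (simp add: G_other integrable_power driver_measurable)
  qed
  ultimately have "(\<integral>x. (\<Prod>d\<in>L. ?G d x) \<partial>M) = (\<Prod>d\<in>L. \<integral>x. ?G d x \<partial>M)"
    by (intro indep_vars_lebesgue_integral) (simp_all add: L_def C)
  moreover have "(\<Prod>d\<in>L. ?G d x) = h (X 0 x) * s ^ T (Suc t) x * of_bool (T t x = n)" for x
  proof -
    have "(\<Prod>d\<in>C. ?G d x) = (\<Prod>d\<in>C. s ^ V d x)"
      by (intro prod.cong refl G_other) (use C in auto)
    also have "\<dots> = s ^ (\<Sum>i = 1..n. Z i t x)"
      by (simp add: C_def prod.reindex inj_on_def power_sum)
    finally show ?thesis
      using C by (simp add: L_def G_Init G_other T_def power_add)
  qed
  moreover have "(\<Prod>d\<in>L. \<integral>x. ?G d x \<partial>M) =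
      (\<integral>x. h (X 0 x) * of_bool (T t x = n) \<partial>M) * (psi m r s ^ n * pgf M (eps 1) s)"
  proof -
    have "(\<Prod>d\<in>C. \<integral>x. ?G d x \<partial>M) = (\<Prod>d\<in>C. pgf M (V d) s)"
      unfolding pgf_def
      by (intro prod.cong refl Bochner_Integration.integral_cong G_other) (use C in auto)
    also have "\<dots> = (\<Prod>i = 1..n. pgf M (Z i t) s)"
      by (simp add: C_def prod.reindex inj_on_def)
    also have "\<dots> = (\<Prod>i = 1..n. psi m r s)"
      using INAR s by (intro prod.cong) (auto simp: INAR1_def)
    finally show ?thesis
      using C pgf_eps[of t s] by (simp add: L_def G_Init G_other pgf_def)
  qed
  ultimately show ?thesis
    by simp
qed

text \<open>The one fact about the recursion that is used, together with stationarity, for all four claims. Given the past up to time \<open>t\<close>, \<open>X (t + 1)\<close>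
is a sum of \<open>X t\<close> independent variables with generating function \<open>psi\<close>, and an independent innovation.
Summing over the values of \<open>X t\<close> replaces a conditional expectation.\<close>

lemma weighted_pgf_step:
  fixes h :: "nat \<Rightarrow> real"
  assumes R: "(m, r) \<in> R1" and h: "integrable M (\<lambda>x. h (X 0 x))" and s: "0 \<le> s" "s \<le> 1"
  shows "(\<integral>x. h (X 0 x) * s ^ X (Suc t) x \<partial>M) =
    (\<integral>x. h (X 0 x) * psi m r s ^ X t x \<partial>M) * pgf M (eps 1) s"
proof -
  define T where "T t x = trajectory t (\<lambda>d. V d x)" for t x
  have T [measurable]: "T t \<in> measurable M (count_space UNIV)" for t
    unfolding T_def by (rule trajectory_V_measurable)
  have AE_T: "AE x in M. X t x = T t x" for t
    unfolding T_def by (rule AE_X_eq_trajectory)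
  have psi: "0 \<le> psi m r s" "psi m r s \<le> 1"
    using psi_bounds[OF R s] by auto
  have X_T: "(\<integral>x. h (X 0 x) * u ^ X t x \<partial>M) = (\<integral>x. h (X 0 x) * u ^ T t x \<partial>M)" for u t
    by (rule integral_cong_AE) (use AE_T[of t] in \<open>auto elim!: eventually_mono\<close>)
  have split: "(\<integral>x. h (X 0 x) * s ^ T (Suc t) x * of_bool (T t x = n) \<partial>M) =
      (\<integral>x. h (X 0 x) * psi m r s ^ T t x * pgf M (eps 1) s * of_bool (T t x = n) \<partial>M)" for n
  proof -
    have "h (X 0 x) * psi m r s ^ T t x * pgf M (eps 1) s * of_bool (T t x = n) =
        h (X 0 x) * of_bool (T t x = n) * (psi m r s ^ n * pgf M (eps 1) s)" for x
      by simp
    then show ?thesis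
      by (simp only: expectation_given_value[OF h s, of t n, folded T_def]) simp
  qed
  have "(\<integral>x. h (X 0 x) * s ^ T (Suc t) x \<partial>M) =
      (\<Sum>n. \<integral>x. h (X 0 x) * s ^ T (Suc t) x * of_bool (T t x = n) \<partial>M)"
    by (intro integral_sum_over_values integrable_weighted_power T h s)
  also have "\<dots> = (\<Sum>n. \<integral>x. h (X 0 x) * psi m r s ^ T t x * pgf M (eps 1) s * of_bool (T t x = n) \<partial>M)"
    by (simp only: split)
  also have "\<dots> = (\<integral>x. h (X 0 x) * psi m r s ^ T t x * pgf M (eps 1) s \<partial>M)"
    by (intro integral_sum_over_values[symmetric] integrable_mult_left integrable_weighted_power T h psi)
  also have "\<dots> = (\<integral>x. h (X 0 x) * psi m r s ^ T t x \<partial>M) * pgf M (eps 1) s"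
    by simp
  finally show ?thesis
    unfolding X_T .
qed

end

end

section \<open>Variances and shifts in time\<close>

lemma variance_equation:
  fixes m r q q' \<mu> \<mu>' v v' :: real
  assumes q: "q = m\<^sup>2 * q + (q' + r * m * \<mu> + m * \<mu> * \<mu>')" and \<mu>': "\<mu>' = (1 - m) * \<mu>"
    and v: "v = 2 * q + \<mu> - \<mu>\<^sup>2" and v': "v' = 2 * q' + \<mu>' - \<mu>'\<^sup>2"
  shows "(1 - m\<^sup>2) * v = m * (2 * r + 1 - m) * \<mu> + v'"
proof -
  have "(1 - m\<^sup>2) * v = 2 * (q - m\<^sup>2 * q) + (1 - m\<^sup>2) * (\<mu> - \<mu>\<^sup>2)"
    by (simp add: v algebra_simps)
  also have "q - m\<^sup>2 * q = q' + r * m * \<mu> + m * \<mu> * \<mu>'"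
    using q by linarith
  finally show ?thesis
    by (simp add: v' \<mu>' algebra_simps power2_eq_square)
qed

context prob_space
begin

lemma integrable_factorial_moment:
  assumes "finite_mean M Y" "finite_var M Y"
  shows "integrable M (\<lambda>x. real (Y x) * (real (Y x) - 1) / 2)"
proof -
  have "real (Y x) * (real (Y x) - 1) / 2 =
      ((real (Y x) - mean M Y)\<^sup>2 + (2 * mean M Y - 1) * real (Y x) - (mean M Y)\<^sup>2) / 2" for x
    by (simp add: power2_eq_square algebra_simps)
  then show ?thesis
    using assms by (simp add: finite_mean_def finite_var_def)
qed

lemma var_from_factorial_moment:
  assumes Y1: "integrable M (\<lambda>x. real (Y x))"
    and Y2: "integrable M (\<lambda>x. real (Y x) * (real (Y x) - 1) / 2)"
  shows "finite_var M Y"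
    and "var M Y = 2 * (\<integral>x. real (Y x) * (real (Y x) - 1) / 2 \<partial>M) + mean M Y - (mean M Y)\<^sup>2"
proof -
  let ?q = "\<lambda>x. real (Y x) * (real (Y x) - 1) / 2"
  have eq: "(real (Y x) - mean M Y)\<^sup>2 =
      2 * ?q x + (1 - 2 * mean M Y) * real (Y x) + (mean M Y)\<^sup>2" for x
    by (simp add: power2_eq_square field_simps)
  show "finite_var M Y"
    unfolding finite_var_def eq
    by (intro Bochner_Integration.integrable_add integrable_mult_right Y1 Y2) simp
  have "var M Y = 2 * integral\<^sup>L M ?q + (1 - 2 * mean M Y) * mean M Y + (mean M Y)\<^sup>2"
    unfolding var_def eq
    by (simp only: Bochner_Integration.integral_add integrable_mult_right Y1 Y2 mean_def
          Bochner_Integration.integrable_add integrable_const integral_mult_right_zero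
          lebesgue_integral_const prob_space scaleR_one)
  then show "var M Y = 2 * integral\<^sup>L M ?q + mean M Y - (mean M Y)\<^sup>2"
    by (simp add: power2_eq_square algebra_simps)
qed

text \<open>A variable that is almost surely equal to its mean takes a single integer value; flooring the mean
turns this real number into that integer.\<close>

lemma degenerate_if_var_0:
  assumes "finite_var M Y" "var M Y = 0"
  shows "degenerate M Y"
proof -
  have "AE x in M. (real (Y x) - mean M Y)\<^sup>2 = 0"
    using assms integral_nonneg_eq_0_iff_AE[of M "\<lambda>x. (real (Y x) - mean M Y)\<^sup>2"]
    by (simp add: finite_var_def var_def)
  then have "AE x in M. Y x = nat \<lfloor>mean M Y\<rfloor>"
    by eventually_elim (metis diff_eq_eq add_0 floor_of_nat nat_int power2_eq_iff_nonneg
        order_refl zero_power2 power_eq_0_iff)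
  then show ?thesis
    by (auto simp: degenerate_def)
qed

lemma stationary_integral_pair:
  fixes f :: "nat \<Rightarrow> nat \<Rightarrow> real"
  assumes stat: "strictly_stationary M X"
    and X [measurable]: "\<And>t. X t \<in> measurable M (count_space UNIV)"
  shows "(\<integral>x. f (X t x) (X (t + k) x) \<partial>M) = (\<integral>x. f (X 0 x) (X k x) \<partial>M)" (is ?eq)
    and "integrable M (\<lambda>x. f (X t x) (X (t + k) x)) \<longleftrightarrow> integrable M (\<lambda>x. f (X 0 x) (X k x))" (is ?int)
proof -
  define J where "J = {0, k}"
  let ?P = "PiM J (\<lambda>_. count_space (UNIV :: nat set))"
  let ?g = "\<lambda>v. f (v 0) (v k)"
  have comp: "(\<lambda>v. v i) \<in> measurable ?P (count_space UNIV)" if "i \<in> J" for i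
    using that by (intro measurable_component_singleton)
  have g: "?g \<in> borel_measurable ?P"
  proof (rule measurable_compose_countable[where g = "\<lambda>v. v 0" and f = "\<lambda>a v. f a (v k)"])
    show "(\<lambda>v. f a (v k)) \<in> borel_measurable ?P" for a
      by (rule measurable_compose[OF comp]) (auto simp: J_def)
    show "(\<lambda>v. v 0) \<in> measurable ?P (count_space UNIV)"
      by (rule comp) (simp add: J_def)
  qed
  have shift: "(\<lambda>x. \<lambda>i\<in>J. X (i + h) x) \<in> measurable M ?P" for h
    by (intro measurable_restrict X)
  have eq: "distr M ?P (\<lambda>x. \<lambda>i\<in>J. X (i + t) x) = distr M ?P (\<lambda>x. \<lambda>i\<in>J. X i x)"
    using stat by (simp add: strictly_stationary_def J_def)
  have J: "0 \<in> J" "k \<in> J"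
    by (auto simp: J_def)
  show ?eq
    using arg_cong[OF eq, of "\<lambda>N. integral\<^sup>L N ?g"] integral_distr[OF shift g, of t]
      integral_distr[OF shift g, of 0] J
    by (simp add: add.commute)
  show ?int
    using arg_cong[OF eq, of "\<lambda>N. integrable N ?g"] integrable_distr_eq[OF shift g, of t]
      integrable_distr_eq[OF shift g, of 0] J
    by (simp add: add.commute)
qed

lemma stationary_integral:
  fixes f :: "nat \<Rightarrow> real"
  assumes "strictly_stationary M X" "\<And>t. X t \<in> measurable M (count_space UNIV)"
  shows "(\<integral>x. f (X t x) \<partial>M) = (\<integral>x. f (X 0 x) \<partial>M)"
    and "integrable M (\<lambda>x. f (X t x)) \<longleftrightarrow> integrable M (\<lambda>x. f (X 0 x))"
  using stationary_integral_pair[OF assms, of "\<lambda>a _. f a" t 0] by simp_all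

section \<open>Stationary INAR(1) processes\<close>

text \<open>The step formula with weight \<open>X 0\<close> is the functional equation with total mass \<open>mean M (X 0)\<close>; its first
difference quotients tend to the product moments at lags \<open>k + 1\<close> and \<open>k\<close>.\<close>

lemma product_moment_step:
  assumes INAR: "INAR1 M m r X eps Z" and R: "(m, r) \<in> R1"
    and e1: "integrable M (\<lambda>x. real (eps 1 x))" and X1: "integrable M (\<lambda>x. real (X 0 x))"
    and prod: "\<And>k. integrable M (\<lambda>x. real (X 0 x) * real (X k x))"
  shows "(\<integral>x. real (X 0 x) * real (X (Suc k) x) \<partial>M) =
    m * (\<integral>x. real (X 0 x) * real (X k x) \<partial>M) + mean M (X 0) * mean M (eps 1)"
proof -
  note X = X_measurable[OF INAR]
  have e: "eps 1 \<in> measurable M (count_space UNIV)"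
    by (rule eps_measurable[OF INAR]) simp
  obtain g where g: "approaching_1 g"
    using approaching_1_ex by blast
  have g01: "0 \<le> g j" "g j < 1" for j
    using g by (auto simp: approaching_1_def)
  let ?D = "\<lambda>k s. \<integral>x. real (X 0 x) * quot1 (X k x) s \<partial>M"
  have step: "?D (Suc k) s = m / (1 + r * (1 - s)) * ?D k (psi m r s) * pgf M (eps 1) s +
      mean M (X 0) * (\<integral>x. quot1 (eps 1 x) s \<partial>M)" if s: "0 \<le> s" "s < 1" for s
  proof (rule first_difference_quotient[where u = "1 - s"])
    have psi: "0 \<le> psi m r s" "psi m r s < 1"
      using psi_bounds[OF R, of s] psi_less_1[OF R, of s] s by auto
    show "mean M (X 0) - (1 - s) * ?D (Suc k) s =
        (mean M (X 0) - m / (1 + r * (1 - s)) * (1 - s) * ?D k (psi m r s)) * pgf M (eps 1) s"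
      using weighted_pgf_step[OF INAR R X1 s(1), of k] s
        integral_weighted_power[OF X s X1, of "Suc k"] integral_weighted_power[OF X psi X1, of k]
      by (simp only: one_minus_psi mean_def less_imp_le)
    show "pgf M (eps 1) s = 1 - (1 - s) * (\<integral>x. quot1 (eps 1 x) s \<partial>M)"
      by (rule pgf_eq_quot1[OF e s])
  qed (use s in simp)
  have lim: "(\<lambda>j. m / (1 + r * (1 - g j)) * ?D k (psi m r (g j)) * pgf M (eps 1) (g j) +
      mean M (X 0) * (\<integral>x. quot1 (eps 1 x) (g j) \<partial>M))
    \<longlonglongrightarrow> m * (\<integral>x. real (X 0 x) * real (X k x) \<partial>M) * 1 + mean M (X 0) * mean M (eps 1)"
    by (intro tendsto_intros thinning_factor_tendsto integral_quot1_tendsto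
          integral_weighted_quot1_tendsto approaching_1_psi pgf_tendsto_1 X e R g e1 X1 prod)
  have "(\<lambda>j. ?D (Suc k) (g j)) \<longlonglongrightarrow> (\<integral>x. real (X 0 x) * real (X (Suc k) x) \<partial>M)"
    by (intro integral_weighted_quot1_tendsto X g X1 prod)
  from LIMSEQ_unique[OF this[unfolded step[OF g01]] lim] show ?thesis
    by (simp only: mult_1_right)
qed

end

theorem proposition3p4:
  fixes M :: "'a measure" and m r :: real
    and X eps :: "nat \<Rightarrow> 'a \<Rightarrow> nat" and Z :: "nat \<Rightarrow> nat \<Rightarrow> 'a \<Rightarrow> nat"
  assumes "prob_space M"
    and "(m, r) \<in> R1"
    and "INAR1 M m r X eps Z"
    and "strictly_stationary M X"
  shows
    "(\<forall>t. \<forall>s\<in>{0..1}. pgf M (X t) s = pgf M (X t) (psi m r s) * pgf M (eps 1) s) \<and>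
     (finite_mean M (eps 1) \<and> finite_var M (eps 1) \<longrightarrow>
       (\<forall>t k. k \<le> t \<longrightarrow> \<not> degenerate M (X t) \<longrightarrow> corr M (X (t - k)) (X t) = m ^ k)) \<and>
     (finite_mean M (eps 1) \<and> finite_var M (eps 1) \<longrightarrow>
       (\<forall>t. finite_mean M (X t) \<and> finite_var M (X t) \<and>
         mean M (X t) = mean M (eps 1) / (1 - m) \<and>
         var M (X t) = (m * (2 * r + 1 - m) * mean M (X t) + var M (eps 1)) / (1 - m\<^sup>2))) \<and>
     (\<forall>t\<ge>1. \<forall>s1\<in>{0..1}. \<forall>s2\<in>{0..1}.
       joint_pgf M (X (t - 1)) (X t) s1 s2 =
         pgf M (X t) (s1 * psi m r s2) * pgf M (X t) s2 / pgf M (X t) (psi m r s2))"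
proof -
  interpret prob_space M by fact
  note R = assms(2) and INAR = assms(3) and stat = assms(4)
  note X = X_measurable[OF INAR]
  note shift = stationary_integral[OF stat X]
  have m: "0 < m" "m < 1" "0 \<le> r"
    using R by (auto simp: R1_def)
  have e: "eps 1 \<in> measurable M (count_space UNIV)"
    by (rule eps_measurable[OF INAR]) simp
  have pgf_X: "pgf M (X t) s = pgf M (X 0) s" for t s
    unfolding pgf_def by (rule shift)
  have mean_X: "mean M (X t) = mean M (X 0)" for t
    unfolding mean_def by (rule shift)
  have var_X: "var M (X t) = var M (X 0)" for t
    unfolding var_def mean_X[of t] by (rule shift)

  have eq: "pgf M (X t) s = pgf M (X t) (psi m r s) * pgf M (eps 1) s" if s: "0 \<le> s" "s \<le> 1" for t s
    using weighted_pgf_step[OF INAR R _ s, of "\<lambda>_. 1" 0] pgf_X[of 1 s] pgf_X[of t]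
    by (simp add: pgf_def)

  (* By stationarity the pair may be moved to times 0 and 1. The quotient of generating functions is
     the innovation's generating function; psi is bounded away from 0, so the denominator is positive. *)
  have joint: "joint_pgf M (X (t - 1)) (X t) s1 s2 =
      pgf M (X t) (s1 * psi m r s2) * pgf M (X t) s2 / pgf M (X t) (psi m r s2)"
    if t: "1 \<le> t" and s1: "0 \<le> s1" "s1 \<le> 1" and s2: "0 \<le> s2" "s2 \<le> 1" for t s1 s2
  proof -
    have "joint_pgf M (X (t - 1)) (X t) s1 s2 = (\<integral>x. s1 ^ X 0 x * s2 ^ X (Suc 0) x \<partial>M)"
      using stationary_integral_pair(1)[OF stat X, of "\<lambda>a b. s1 ^ a * s2 ^ b" "t - 1" 1] t
      by (simp add: joint_pgf_def)
    also have "\<dots> = (\<integral>x. s1 ^ X 0 x * psi m r s2 ^ X 0 x \<partial>M) * pgf M (eps 1) s2"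
      by (rule weighted_pgf_step[OF INAR R integrable_power[OF X s1] s2])
    also have "(\<integral>x. s1 ^ X 0 x * psi m r s2 ^ X 0 x \<partial>M) = pgf M (X t) (s1 * psi m r s2)"
      unfolding pgf_X[of t] by (simp add: pgf_def power_mult_distrib)
    finally show ?thesis
      using eq[OF s2, of t] pgf_pos[OF X psi_bounds(1,2)[OF R s2], of t] by simp
  qed

  have moments: "finite_mean M (X t) \<and> finite_var M (X t) \<and>
         mean M (X t) = mean M (eps 1) / (1 - m) \<and>
         var M (X t) = (m * (2 * r + 1 - m) * mean M (X t) + var M (eps 1)) / (1 - m\<^sup>2)"
    and corr: "k \<le> t \<Longrightarrow> \<not> degenerate M (X t) \<Longrightarrow> corr M (X (t - k)) (X t) = m ^ k"
    if fm: "finite_mean M (eps 1)" and fv: "finite_var M (eps 1)" for t k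
  proof -
    have e1: "integrable M (\<lambda>x. real (eps 1 x))"
      using fm by (simp add: finite_mean_def)
    have e2: "integrable M (\<lambda>x. real (eps 1 x) * (real (eps 1 x) - 1) / 2)"
      using fm fv by (rule integrable_factorial_moment)
    have eq': "pgf M (X t) s = pgf M (X t) (psi m r s) * pgf M (eps 1) s"
      if "0 \<le> s" "s < 1" for t s
      using eq that by simp
    have X1: "integrable M (\<lambda>x. real (X t x))" for t
      by (rule solution_integrable[OF X e R eq' e1])
    have X2: "integrable M (\<lambda>x. real (X t x) * (real (X t x) - 1) / 2)" for t
      by (rule solution_integrable_factorial_moment[OF X e R eq' e1 e2])
    have mean_eq: "mean M (eps 1) = (1 - m) * mean M (X t)" for t
      using solution_mean[OF X e R eq' e1, of t] by (simp add: algebra_simps)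
    have fv_X: "finite_var M (X t)" for t
      by (rule var_from_factorial_moment(1)[OF X1 X2])
    have m2: "m\<^sup>2 < 1"
      using m by (simp add: power_less_one_iff)
    have "(1 - m\<^sup>2) * var M (X t) = m * (2 * r + 1 - m) * mean M (X t) + var M (eps 1)"
      by (rule variance_equation[OF solution_factorial_moment[OF X e R eq' e1 e2] mean_eq
            var_from_factorial_moment(2)[OF X1 X2] var_from_factorial_moment(2)[OF e1 e2]])
    then show "finite_mean M (X t) \<and> finite_var M (X t) \<and>
         mean M (X t) = mean M (eps 1) / (1 - m) \<and>
         var M (X t) = (m * (2 * r + 1 - m) * mean M (X t) + var M (eps 1)) / (1 - m\<^sup>2)"
      using m m2 X1 fv_X mean_eq[of t] by (simp add: finite_mean_def field_simps)

    show "corr M (X (t - k)) (X t) = m ^ k" if kt: "k \<le> t" and nd: "\<not> degenerate M (X t)"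
    proof -
      let ?\<mu> = "mean M (X 0)"
      have square: "integrable M (\<lambda>x. (real (X t x))\<^sup>2)" for t
      proof -
        have "(real (X t x))\<^sup>2 = 2 * (real (X t x) * (real (X t x) - 1) / 2) + real (X t x)" for x
          by (simp add: power2_eq_square field_simps)
        then show ?thesis
          by (simp only:) (intro Bochner_Integration.integrable_add integrable_mult_right X1 X2)
      qed
      have prod: "integrable M (\<lambda>x. real (X 0 x) * real (X k x))" for k
      proof (rule Bochner_Integration.integrable_bound)
        show "integrable M (\<lambda>x. (real (X 0 x))\<^sup>2 + (real (X k x))\<^sup>2)"
          by (intro Bochner_Integration.integrable_add square)
        show "(\<lambda>x. real (X 0 x) * real (X k x)) \<in> borel_measurable M"
          using X[of 0] X[of k] by measurable
        have "a * b \<le> a\<^sup>2 + b\<^sup>2" if "0 \<le> a" "0 \<le> b" for a b :: real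
          using sum_squares_bound[of a b] mult_nonneg_nonneg[OF that] by simp
        then show "AE x in M. norm (real (X 0 x) * real (X k x)) \<le> norm ((real (X 0 x))\<^sup>2 + (real (X k x))\<^sup>2)"
          by simp
      qed
      have cov_eq: "cov M (X 0) (X k) = (\<integral>x. real (X 0 x) * real (X k x) \<partial>M) - ?\<mu>\<^sup>2" for k
      proof -
        have "(real (X 0 x) - ?\<mu>) * (real (X k x) - ?\<mu>) =
            real (X 0 x) * real (X k x) - ?\<mu> * real (X 0 x) - ?\<mu> * real (X k x) + ?\<mu>\<^sup>2" for x
          by (simp add: power2_eq_square algebra_simps)
        then show ?thesis
          using prod[of k] X1[of 0] X1[of k] mean_X[of k]
          by (simp add: cov_def prob_space) (simp add: mean_def power2_eq_square)
      qed
      have "cov M (X 0) (X k) = m ^ k * var M (X 0)" for k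
      proof (induction k)
        case 0
        show ?case
          by (simp add: cov_def var_def power2_eq_square)
      next
        case (Suc k)
        (* The innovation mean is (1 - m) times the mean of X, so the mean terms cancel. *)
        have "cov M (X 0) (X (Suc k)) = m * cov M (X 0) (X k)"
          unfolding cov_eq product_moment_step[OF INAR R e1 X1 prod] mean_eq[of 0]
          by (simp add: algebra_simps power2_eq_square)
        then show ?case
          using Suc by simp
      qed
      moreover have "cov M (X (t - k)) (X t) = cov M (X 0) (X k)"
        using stationary_integral_pair(1)[OF stat X, of "\<lambda>a b. (real a - ?\<mu>) * (real b - ?\<mu>)" "t - k" k] kt
        by (simp add: cov_def mean_X[of t] mean_X[of "t - k"] mean_X[of k])
      moreover have "var M (X t) \<noteq> 0"
        using nd degenerate_if_var_0[OF fv_X] by blast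
      moreover have "0 \<le> var M (X 0)"
        by (simp add: var_def)
      ultimately show ?thesis
        using var_X[of t] var_X[of "t - k"] by (simp add: corr_def)
    qed
  qed
  show ?thesis
    using eq joint moments corr by (intro conjI impI allI ballI) simp_all
qed

end
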